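(* Let $G$ be a connected graph of order $n$ and diameter $\omega$, with minimum degree $\delta$ and second minimum degree $\delta'$. Then $$\rho^S(G)\le\sqrt{\big(-2\delta(\omega-1)+\omega(1-\omega)+2n\omega-n-1\big)\big(-2\delta'(\omega-1)+\omega(1-\omega)+2n\omega-n-1\big)},$$ with equality if and only if $G$ is regular with diameter at most $2$.
   Context: The distance Seidel matrix of a connected graph $G$ is $\mathcal{D}^S(G)=J-I-2\mathcal{D}(G)$, where $\mathcal{D}(G)$ is the distance matrix and $J$ the all-ones matrix; $\rho^S(G)=\max_i|\partial_i^S|$ over its eigenvalues (equivalently the largest eigenvalue of $-\mathcal{D}^S(G)$). The second minimum degree $\delta'$ is the second entry of the degree sequence written in non-decreasing order (it may equal $\delta$). *)

theory Defs
  imports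
    "Graph_Theory.Digraph_Component"
    "Graph_Theory.Shortest_Path"
    "Jordan_Normal_Form.Spectral_Radius"
    "HOL-Library.Multiset"
begin

text \<open>
  A finite simple graph is an instance of the locale \<open>graph\<close> of the AFP entry Graph Theory:
  a finite, symmetric digraph without loops and parallel arcs. An undirected edge is
  a pair of opposite arcs, so the degree of a vertex is its \<open>out_degree\<close>.
\<close>

definition vertex_dist :: "('a, 'b) pre_digraph \<Rightarrow> 'a \<Rightarrow> 'a \<Rightarrow> nat" where
  "vertex_dist G u v = (LEAST k. \<exists>p. pre_digraph.apath G u p v \<and> length p = k)"

text \<open>On graphs this is the library's shortest-path cost for unit weights.\<close>

lemma vertex_dist_eq_unit_cost:
  assumes G: "graph G" and reach: "u \<rightarrow>\<^sup>*\<^bsub>G\<^esub> v"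
  shows "ereal (real (vertex_dist G u v)) = wf_digraph.\<mu> G (\<lambda>_. 1) u v"
proof -
  interpret graph G by (rule G)
  have cost: "awalk_cost (\<lambda>_. 1) p = real (length p)" for p
    by (induction p) auto
  obtain p where p: "apath u p v" "\<mu> (\<lambda>_. 1) u v = real (length p)"
    using no_neg_cyc_reach_imp_path[OF reach, of "\<lambda>_. 1"] by (auto simp: cost)
  have "length p \<le> length q" if "apath u q v" for q
    using min_cost_le_walk_cost[of u q v "\<lambda>_. 1"] that p
    by (auto simp: apath_def cost)
  then have "vertex_dist G u v = length p"
    unfolding vertex_dist_def using p(1) by (intro Least_equality) auto
  then show ?thesis
    using p(2) by simp
qed

definition diameter :: "('a, 'b) pre_digraph \<Rightarrow> nat" where
  "diameter G = Max {vertex_dist G u v | u v. u \<in> verts G \<and> v \<in> verts G}"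

definition degree_sequence :: "('a, 'b) pre_digraph \<Rightarrow> nat list" where
  "degree_sequence G = sorted_list_of_multiset (image_mset (out_degree G) (mset_set (verts G)))"

definition min_degree :: "('a, 'b) pre_digraph \<Rightarrow> nat" where
  "min_degree G = Min (out_degree G ` verts G)"

text \<open>Meaningful for graphs with at least two vertices only.\<close>

definition second_min_degree :: "('a, 'b) pre_digraph \<Rightarrow> nat" where
  "second_min_degree G = degree_sequence G ! 1"

definition regular_graph :: "('a, 'b) pre_digraph \<Rightarrow> bool" where
  "regular_graph G \<longleftrightarrow> (\<exists>k. \<forall>v\<in>verts G. out_degree G v = k)"

text \<open>The matrices are indexed through a list \<open>vs\<close> enumerating the vertices.\<close>

definition all_ones_matrix :: "nat \<Rightarrow> real mat" where
  "all_ones_matrix n = mat n n (\<lambda>_. 1)"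

definition distance_matrix :: "('a, 'b) pre_digraph \<Rightarrow> 'a list \<Rightarrow> real mat" where
  "distance_matrix G vs =
     mat (length vs) (length vs) (\<lambda>(i, j). real (vertex_dist G (vs ! i) (vs ! j)))"

definition distance_seidel_matrix :: "('a, 'b) pre_digraph \<Rightarrow> 'a list \<Rightarrow> real mat" where
  "distance_seidel_matrix G vs =
     all_ones_matrix (length vs) - 1\<^sub>m (length vs) - 2 \<cdot>\<^sub>m distance_matrix G vs"

text \<open>
  The library's spectral radius is defined for complex matrices. The matrix here is real
  symmetric, so its complex eigenvalues are its real ones.
\<close>

definition distance_seidel_radius :: "('a, 'b) pre_digraph \<Rightarrow> 'a list \<Rightarrow> real" where
  "distance_seidel_radius G vs =
     spectral_radius (map_mat complex_of_real (distance_seidel_matrix G vs))"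

end

theory Submission
  imports Defs
begin

text \<open>
  Off the diagonal the matrix \<open>- D\<^sup>S\<close> has the positive entries \<open>2 d(u, v) - 1\<close>. Comparing the two
  largest entries of the absolute value of an eigenvector, as in Brauer's theorem on ovals of
  Cassini, gives \<open>\<rho>\<^sup>2 \<le> T(s) T(t)\<close> for two distinct vertices, where \<open>T\<close> denotes the row sums.

  A vertex \<open>u\<close> has at least \<open>k - 1\<close> vertices at distance between 2 and \<open>k\<close>, for each \<open>k < \<omega>\<close>: either
  all these layers are nonempty, or they contain every vertex outside the closed neighbourhood of
  \<open>u\<close>, which meets at most three of the \<open>\<omega> + 1\<close> layers around an endpoint of a diametral path.
  Summing over \<open>k\<close> bounds \<open>T(u)\<close> by an expression that decreases with the degree of \<open>u\<close>.

  In the equality case the entries of the eigenvector have equal absolute value, so \<open>\<rho> \<le> T(u)\<close> for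
  every \<open>u\<close>. This forces the graph to be regular and all these estimates to be equalities; for
  \<open>\<omega> \<ge> 3\<close> every vertex then has exactly one vertex at distance 2, which is impossible
  in a regular graph.
\<close>

subsection \<open>Spectral radius and row sums\<close>

text \<open>Let \<open>s\<close> carry the largest entry of \<open>x\<close> and \<open>t\<close>
  the largest among the rest. Row \<open>s\<close> does not involve \<open>x s\<close>, so
  \<open>\<rho> * x s \<le> T s * x t\<close>; likewise \<open>\<rho> * x t \<le> T t * x s\<close>;
  multiply and cancel. With only two vertices, equality does not force \<open>x s = x t\<close>,
  hence the guard \<open>card V \<ge> 3\<close>.\<close>

lemma brauer_bound:
  fixes V :: "'a set" and m :: "'a \<Rightarrow> 'a \<Rightarrow> real" and x :: "'a \<Rightarrow> real" and \<rho> :: real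
  defines "T \<equiv> \<lambda>u. \<Sum>v\<in>V - {u}. m u v"
  assumes V: "finite V" "card V \<ge> 2"
    and pos: "\<And>u v. u \<in> V \<Longrightarrow> v \<in> V \<Longrightarrow> u \<noteq> v \<Longrightarrow> m u v > 0"
    and nonneg: "\<And>u. u \<in> V \<Longrightarrow> x u \<ge> 0"
    and nonzero: "\<exists>u\<in>V. x u > 0"
    and eig: "\<And>u. u \<in> V \<Longrightarrow> \<rho> * x u \<le> (\<Sum>v\<in>V - {u}. m u v * x v)"
    and \<rho>: "\<rho> \<ge> 0"
  obtains s t where "s \<in> V" "t \<in> V" "s \<noteq> t" "\<rho>\<^sup>2 \<le> T s * T t"
    "\<rho>\<^sup>2 = T s * T t \<longrightarrow> card V \<ge> 3 \<longrightarrow> (\<forall>u\<in>V. \<rho> \<le> T u)"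
proof -
  have max: "\<exists>s\<in>W. \<forall>u\<in>W. x u \<le> x s" if "finite W" "W \<noteq> {}" for W
  proof -
    have "Max (x ` W) \<in> x ` W" using that by (intro Max_in) auto
    then obtain s where "s \<in> W" "x s = Max (x ` W)" by auto
    then show ?thesis using that by (auto intro!: bexI[of _ s])
  qed
  have "V \<noteq> {}" using V by auto
  then obtain s where s: "s \<in> V" "\<And>u. u \<in> V \<Longrightarrow> x u \<le> x s"
    using max[OF V(1)] by blast
  have "card (V - {s}) > 0" using V s by (simp add: card_Diff_singleton)
  then have "V - {s} \<noteq> {}" by (metis card.empty less_irrefl)
  then obtain t where t: "t \<in> V - {s}" "\<And>u. u \<in> V - {s} \<Longrightarrow> x u \<le> x t"
    using max[of "V - {s}"] finite_Diff[OF V(1)] by (metis (no_types))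
  have st: "t \<in> V" "s \<noteq> t" using t by auto
  have T_pos: "T u > 0" if "u \<in> V" for u
  proof -
    have "V - {u} \<noteq> {}" using s st by auto
    then show ?thesis
      unfolding T_def using V(1) that by (intro sum_pos) (auto intro!: pos)
  qed
  have xs: "x s > 0" using nonzero s(2) by (meson dual_order.strict_trans1)
  have row: "\<rho> * x u \<le> T u * c" if "u \<in> V" "\<And>v. v \<in> V - {u} \<Longrightarrow> x v \<le> c" for u c
  proof -
    have "(\<Sum>v\<in>V - {u}. m u v * x v) \<le> (\<Sum>v\<in>V - {u}. m u v * c)"
      using that pos by (intro sum_mono mult_left_mono) (auto simp: less_imp_le)
    then show ?thesis using eig[OF that(1)] by (simp add: T_def sum_distrib_right)
  qed
  have row_eq: "x v = c" if "u \<in> V" "\<And>v. v \<in> V - {u} \<Longrightarrow> x v \<le> c" "\<rho> * x u = T u * c" "v \<in> V - {u}" for u v c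
  proof (rule ccontr)
    assume "x v \<noteq> c"
    then have "x v < c" using that by force
    then have "(\<Sum>v\<in>V - {u}. m u v * x v) < (\<Sum>v\<in>V - {u}. m u v * c)"
      using that pos V(1) by (intro sum_strict_mono_ex1) (auto simp: less_imp_le intro!: bexI[of _ v] mult_left_mono)
    then show False using eig[OF that(1)] that(3) by (simp add: T_def sum_distrib_right)
  qed
  have rs: "\<rho> * x s \<le> T s * x t" using row s t by blast
  have rt: "\<rho> * x t \<le> T t * x s" using row st s by blast
  have le: "\<rho>\<^sup>2 \<le> T s * T t" 
  \<comment> \<open>For \<open>\<rho> = 0\<close> the entry \<open>x t\<close> may vanish, so it
    could not be cancelled.\<close>
  proof (cases "\<rho> = 0")
    case True
    then show ?thesis using T_pos s st by (simp add: less_imp_le)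
  next
    case False
    then have "\<rho> * x s > 0" using \<rho> xs by simp
    then have xt: "x t > 0" using rs T_pos[OF s(1)] by (meson less_le_trans zero_less_mult_pos)
    have "(\<rho> * x s) * (\<rho> * x t) \<le> (T s * x t) * (T t * x s)"
      using \<rho> xs xt T_pos[OF s(1)] by (intro mult_mono[OF rs rt]) auto
    then have "\<rho>\<^sup>2 * (x s * x t) \<le> (T s * T t) * (x s * x t)"
      by (simp add: power2_eq_square algebra_simps)
    then show ?thesis using xs xt by (simp add: mult_le_cancel_right)
  qed
  have "\<forall>u\<in>V. \<rho> \<le> T u" if eq: "\<rho>\<^sup>2 = T s * T t" and card3: "card V \<ge> 3"
  proof -
    have \<rho>_pos: "\<rho> > 0" using eq T_pos[OF s(1)] T_pos[OF st(1)] \<rho>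
      by (metis less_eq_real_def mult_pos_pos power_zero_numeral less_irrefl)
    have xt: "x t > 0" using rs T_pos[OF s(1)] \<rho>_pos xs
      by (meson less_le_trans zero_less_mult_pos mult_pos_pos)
    have prod: "(\<rho> * x s) * (\<rho> * x t) = (T s * x t) * (T t * x s)"
      using eq by (simp add: power2_eq_square algebra_simps)
    \<comment> \<open>Equality in a product of two inequalities between positive numbers forces
      equality in both factors.\<close>
    have es: "\<rho> * x s = T s * x t"
    proof (rule ccontr)
      assume "\<rho> * x s \<noteq> T s * x t"
      then have "(\<rho> * x s) * (\<rho> * x t) < (T s * x t) * (T t * x s)"
        using rs \<rho>_pos xs xt by (intro mult_less_le_imp_less[OF _ rt]) auto
      then show False using prod by simp
    qed
    then have et: "\<rho> * x t = T t * x s"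
      using prod \<rho>_pos xs by (metis mult_cancel_left mult_pos_pos less_irrefl)
    have eq_t: "x v = x t" if "v \<in> V - {s}" for v
      using row_eq[OF s(1) t(2) es that] .
    have eq_s: "x v = x s" if "v \<in> V - {t}" for v
      using row_eq[OF st(1) _ et that] s by auto
    \<comment> \<open>Entries off \<open>s\<close> equal \<open>x t\<close> and entries off
      \<open>t\<close> equal \<open>x s\<close>; a third vertex lies in both ranges and identifies
      the two values.\<close>
    have "card (V - {s, t}) \<ge> 1"
      using card3 V(1) s st by (simp add: card_Diff_subset)
    then have "V - {s, t} \<noteq> {}" by (metis card.empty not_one_le_zero)
    then obtain w where "w \<in> V - {s, t}" by blast
    then have "x s = x t" using eq_s[of w] eq_t[of w] by auto
    then have const: "x v = x s" if "v \<in> V" for v using eq_t[of v] that by auto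
    show ?thesis
    proof
      fix u assume u: "u \<in> V"
      have "\<rho> * x u \<le> T u * x s" using row[OF u] s by auto
      then show "\<rho> \<le> T u" using const[OF u] xs by (simp add: mult_le_cancel_right)
    qed
  qed
  with that s st le show ?thesis by blast
qed

text \<open>Taking moduli in the equation of an eigenvector whose eigenvalue has maximal modulus
  gives a nonnegative real vector. The triangle inequality turns the equation into an inequality,
  which is the form \<open>brauer_bound\<close> expects.\<close>

lemma spectral_radius_abs_eigenvector:
  fixes A :: "real mat"
  assumes A: "A \<in> carrier_mat n n" and n: "n > 0"
  obtains x :: "nat \<Rightarrow> real" where "\<And>i. i < n \<Longrightarrow> x i \<ge> 0" "\<exists>i<n. x i > 0"
    "\<And>i. i < n \<Longrightarrow> spectral_radius (map_mat complex_of_real A) * x i \<le> (\<Sum>j<n. \<bar>A $$ (i, j)\<bar> * x j)"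
proof -
  let ?A = "map_mat complex_of_real A"
  have cA: "?A \<in> carrier_mat n n" using A by simp
  obtain k where "eigenvalue ?A k" and k: "spectral_radius ?A = cmod k"
    using spectral_radius_mem_max(1)[OF cA n] by (auto simp: spectrum_def)
  then obtain z where z: "z \<in> carrier_vec n" "z \<noteq> 0\<^sub>v n" "?A *\<^sub>v z = k \<cdot>\<^sub>v z"
    using A by (auto simp: eigenvalue_def eigenvector_def)
  show ?thesis
  proof
    show "\<exists>i<n. cmod (z $ i) > 0"
    proof (rule ccontr)
      assume "\<not> ?thesis"
      then have "z = 0\<^sub>v n" using z(1) by (intro eq_vecI) auto
      then show False using z(2) by simp
    qed
  next
    fix i assume i: "i < n"
    have "k * z $ i = (?A *\<^sub>v z) $ i" using z i by simp
    also have "\<dots> = (\<Sum>j<n. complex_of_real (A $$ (i, j)) * z $ j)"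
      using A z(1) i by (auto simp: scalar_prod_def atLeast0LessThan intro!: sum.cong)
    finally have "cmod k * cmod (z $ i) = cmod (\<Sum>j<n. complex_of_real (A $$ (i, j)) * z $ j)"
      by (metis norm_mult)
    also have "\<dots> \<le> (\<Sum>j<n. \<bar>A $$ (i, j)\<bar> * cmod (z $ j))"
      by (rule order_trans[OF norm_sum]) (simp add: norm_mult)
    finally show "spectral_radius ?A * cmod (z $ i) \<le> (\<Sum>j<n. \<bar>A $$ (i, j)\<bar> * cmod (z $ j))"
      by (simp add: k)
  qed auto
qed

text \<open>The all-ones vector is an eigenvector for \<open>c\<close>. This yields the lower bound
  on the radius in the equality case.\<close>

lemma abs_row_sum_le_spectral_radius:
  fixes A :: "real mat"
  assumes A: "A \<in> carrier_mat n n" and n: "n > 0"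
    and rows: "\<And>i. i < n \<Longrightarrow> (\<Sum>j<n. A $$ (i, j)) = c"
  shows "\<bar>c\<bar> \<le> spectral_radius (map_mat complex_of_real A)"
proof -
  let ?A = "map_mat complex_of_real A" and ?e = "vec n (\<lambda>_. 1 :: complex)"
  have cA: "?A \<in> carrier_mat n n" using A by simp
  have "?A *\<^sub>v ?e = of_real c \<cdot>\<^sub>v ?e"
  proof (rule eq_vecI)
    fix i assume "i < dim_vec (of_real c \<cdot>\<^sub>v ?e)"
    then have i: "i < n" by simp
    have "(?A *\<^sub>v ?e) $ i = (\<Sum>j<n. complex_of_real (A $$ (i, j)))"
      using A i by (auto simp: scalar_prod_def atLeast0LessThan intro!: sum.cong)
    then show "(?A *\<^sub>v ?e) $ i = (of_real c \<cdot>\<^sub>v ?e) $ i"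
      using rows[OF i] i by (simp flip: of_real_sum)
  qed (use A in simp)
  moreover have "?e \<noteq> 0\<^sub>v n" using n by (metis index_vec index_zero_vec(1) zero_neq_one)
  ultimately have "eigenvalue ?A (of_real c)"
    using A unfolding eigenvalue_def eigenvector_def by (intro exI[of _ ?e]) auto
  then show ?thesis
    using spectral_radius_mem_max(2)[OF cA n, of "\<bar>c\<bar>"]
    by (force simp: spectrum_def)
qed

lemma spectral_radius_nonneg:
  assumes "A \<in> carrier_mat n n" and "n > 0"
  shows "spectral_radius A \<ge> 0"
  using spectral_radius_mem_max(1)[OF assms] by auto

subsection \<open>Row sums in terms of degree and diameter\<close>

text \<open>The factor under the square root, as a function of the degree. It equals \<open>k + (n -
  1 - k) * (2 * \<omega> - 1) - (\<omega> - 1) * (\<omega> - 2)\<close>: neighbours contribute 1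
  each, the others at most \<open>2 * \<omega> - 1\<close>, and the last term is the guaranteed
  shortfall.\<close>

definition row_sum_bound :: "nat \<Rightarrow> nat \<Rightarrow> nat \<Rightarrow> real" where
  "row_sum_bound n \<omega> k =
     - 2 * real k * (real \<omega> - 1) + real \<omega> * (1 - real \<omega>) + 2 * real n * real \<omega> - real n - 1"

text \<open>Truncated subtraction makes the terms for \<open>k = 0\<close> and \<open>k = 1\<close>
  both zero, leaving the sum of 1 up to \<open>n - 2\<close>.\<close>

lemma sum_pred_real: "2 * real (\<Sum>k<n. k - 1) = (real n - 1) * (real n - 2)" if "n > 0"
  using that
proof (induction n)
  case (Suc n)
  then show ?case by (cases n) (auto simp: algebra_simps)
qed simp

text \<open>Isolates the properties of the distance on which the combinatorial argument rests, so
  that no arcs or walks occur in it. The assumption \<open>pred\<close> stands in for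
  geodesics.\<close>

locale graph_metric =
  fixes V :: "'a set" and d :: "'a \<Rightarrow> 'a \<Rightarrow> nat" and \<omega> :: nat
  assumes finite_V: "finite V"
    and zero_iff: "u \<in> V \<Longrightarrow> v \<in> V \<Longrightarrow> d u v = 0 \<longleftrightarrow> u = v"
    and sym: "u \<in> V \<Longrightarrow> v \<in> V \<Longrightarrow> d u v = d v u"
    and triangle: "u \<in> V \<Longrightarrow> v \<in> V \<Longrightarrow> w \<in> V \<Longrightarrow> d u w \<le> d u v + d v w"
    and pred: "u \<in> V \<Longrightarrow> v \<in> V \<Longrightarrow> d u v = Suc k \<Longrightarrow> \<exists>w\<in>V. d u w = k \<and> d w v = 1"
    and le_diam: "u \<in> V \<Longrightarrow> v \<in> V \<Longrightarrow> d u v \<le> \<omega>"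
    and diam_attained: "\<exists>a\<in>V. \<exists>b\<in>V. d a b = \<omega>"
begin

definition deg :: "'a \<Rightarrow> nat" where
  "deg u = card {v \<in> V. d u v = 1}"

definition far :: "'a \<Rightarrow> 'a set" where
  "far u = {v \<in> V. d u v \<ge> 2}"

definition row_sum :: "'a \<Rightarrow> real" where
  "row_sum u = (\<Sum>v\<in>V - {u}. 2 * real (d u v) - 1)"

section \<open>Layers around a vertex\<close>

lemma intermediate:
  assumes "u \<in> V" "v \<in> V" "j \<le> d u v"
  shows "\<exists>w\<in>V. d u w = j"
proof -
  have "v \<in> V \<Longrightarrow> d u v = k \<Longrightarrow> j \<le> k \<Longrightarrow> \<exists>w\<in>V. d u w = j" for k v
  proof (induction k arbitrary: v)
    case (Suc k)
    then show ?case using pred[OF assms(1), of v k] by (metis le_Suc_eq)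
  qed auto
  with assms show ?thesis by blast
qed

lemma V_split:
  assumes "u \<in> V"
  shows "V - {u} = {v \<in> V. d u v = 1} \<union> far u"
proof -
  have "v \<noteq> u \<longleftrightarrow> d u v = 1 \<or> d u v \<ge> 2" if "v \<in> V" for v
    using zero_iff[OF assms that] by (cases "d u v = 0"; cases "d u v = 1") auto
  then show ?thesis unfolding far_def by blast
qed

lemma finite_far: "finite (far u)"
  using finite_V by (simp add: far_def)

lemma card_V:
  assumes "u \<in> V"
  shows "card V = 1 + deg u + card (far u)"
proof -
  have "card V = Suc (card (V - {u}))"
    using card.remove[OF finite_V assms] .
  also have "card (V - {u}) = deg u + card (far u)"
    unfolding V_split[OF assms] deg_def
    using finite_V by (subst card_Un_disjoint) (auto simp: far_def)
  finally show ?thesis by simp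
qed

lemma diam_le_card_far:
  assumes u: "u \<in> V"
  shows "\<omega> \<le> card (far u) + 2"
proof -
  obtain a b where ab: "a \<in> V" "b \<in> V" "d a b = \<omega>" using diam_attained by blast
  define p where "p = d a u"
  \<comment> \<open>By the triangle inequality the closed neighbourhood of \<open>u\<close> only
    meets the three removed layers. For \<open>p = 0\<close> truncation merges \<open>p - 1\<close>
    with \<open>p\<close>, which the later bound of 3 on the cardinality absorbs.\<close>
  have "{..\<omega>} - {p - 1, p, p + 1} \<subseteq> d a ` far u"
  proof
    fix j assume j: "j \<in> {..\<omega>} - {p - 1, p, p + 1}"
    then obtain w where w: "w \<in> V" "d a w = j"
      using intermediate[OF ab(1,2), of j] ab(3) by auto
    have "d u w \<ge> 2"
      using triangle[OF ab(1) u w(1)] triangle[OF ab(1) w(1) u] sym[OF u w(1)] j w(2)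
      unfolding p_def by auto
    then show "j \<in> d a ` far u" using w by (auto simp: far_def)
  qed
  then have "card ({..\<omega>} - {p - 1, p, p + 1}) \<le> card (far u)"
    using finite_far by (meson card_image_le card_mono finite_imageI le_trans)
  moreover have "card {..\<omega>} - card {p - 1, p, p + 1} \<le> card ({..\<omega>} - {p - 1, p, p + 1})"
    by (rule diff_card_le_card_Diff) simp
  moreover have "card {p - 1, p, p + 1} \<le> 3"
    by (auto simp: card_insert_if)
  ultimately show ?thesis by auto
qed

lemma card_far_ball_ge:
  assumes u: "u \<in> V" and k: "k < \<omega>"
  shows "k - 1 \<le> card {v \<in> far u. d u v \<le> k}"
proof (cases "\<exists>v\<in>V. d u v \<ge> k")
  \<comment> \<open>Each of the \<open>k - 1\<close> layers from 2 to \<open>k\<close> is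
    nonempty.\<close>
  case True
  then obtain v where v: "v \<in> V" "d u v \<ge> k" by blast
  have "{2..k} \<subseteq> d u ` {v \<in> far u. d u v \<le> k}"
  proof
    fix j assume "j \<in> {2..k}"
    then show "j \<in> d u ` {v \<in> far u. d u v \<le> k}"
      using intermediate[OF u v(1), of j] v(2) by (force simp: far_def)
  qed
  then have "card {2..k} \<le> card {v \<in> far u. d u v \<le> k}"
    using finite_far by (intro surj_card_le) auto
  then show ?thesis by simp
next
  \<comment> \<open>The ball contains all of \<open>far u\<close>, hence at least
    \<open>\<omega> - 2\<close> vertices, and \<open>k < \<omega>\<close> gives
    \<open>k - 1 \<le> \<omega> - 2\<close>.\<close>
  case False
  then have "{v \<in> far u. d u v \<le> k} = far u" by (auto simp: far_def)
  then show ?thesis using diam_le_card_far[OF u] k by simp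
qed

text \<open>Double counting: a vertex at distance \<open>d u v\<close> lies in the balls of radius
  \<open>d u v\<close> up to \<open>\<omega> - 1\<close>, which are \<open>\<omega> - d u v\<close>
  many.\<close>

lemma sum_slack:
  "(\<Sum>v\<in>far u. \<omega> - d u v) = (\<Sum>k<\<omega>. card {v \<in> far u. d u v \<le> k})"
proof -
  have "(\<Sum>v\<in>far u. \<omega> - d u v) = (\<Sum>v\<in>far u. \<Sum>k<\<omega>. if d u v \<le> k then 1 else 0)"
  proof (rule sum.cong[OF refl])
    fix v
    have "(\<Sum>k<\<omega>. if d u v \<le> k then 1 else 0) = card ({..<\<omega>} \<inter> {k. d u v \<le> k})"
      by (simp add: sum.If_cases)
    also have "{..<\<omega>} \<inter> {k. d u v \<le> k} = {d u v..<\<omega>}" by auto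
    finally show "\<omega> - d u v = (\<Sum>k<\<omega>. if d u v \<le> k then 1 else 0)" by simp
  qed
  also have "\<dots> = (\<Sum>k<\<omega>. \<Sum>v\<in>far u. if d u v \<le> k then 1 else 0)"
    by (rule sum.swap)
  also have "\<dots> = (\<Sum>k<\<omega>. card {v \<in> far u. d u v \<le> k})"
    using finite_far by (intro sum.cong) (auto simp: sum.If_cases Int_def intro!: arg_cong[of _ _ card])
  finally show ?thesis .
qed

text \<open>An identity with explicit error terms, so that the equality case can be read off term by
  term. Each error term is nonnegative by \<open>card_far_ball_ge\<close>.\<close>

lemma row_sum_eq:
  assumes u: "u \<in> V" and \<omega>: "\<omega> > 0"
  shows "row_sum u = row_sum_bound (card V) \<omega> (deg u)
    - 2 * (\<Sum>k<\<omega>. real (card {v \<in> far u. d u v \<le> k}) - real (k - 1))"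
proof -
  have "row_sum u = (\<Sum>v\<in>{v \<in> V. d u v = 1}. 2 * real (d u v) - 1) + (\<Sum>v\<in>far u. 2 * real (d u v) - 1)"
    unfolding row_sum_def V_split[OF u]
    using finite_V by (intro sum.union_disjoint) (auto simp: far_def)
  also have "(\<Sum>v\<in>{v \<in> V. d u v = 1}. 2 * real (d u v) - 1) = deg u"
    by (simp add: deg_def)
  also have "(\<Sum>v\<in>far u. 2 * real (d u v) - 1) = (\<Sum>v\<in>far u. 2 * real \<omega> - 1 - 2 * real (\<omega> - d u v))"
    using le_diam[OF u] by (intro sum.cong) (auto simp: far_def of_nat_diff)
  also have "\<dots> = card (far u) * (2 * real \<omega> - 1) - 2 * real (\<Sum>v\<in>far u. \<omega> - d u v)"
    by (simp add: sum_subtractf sum_distrib_left)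
  finally have "row_sum u = real (deg u) + real (card (far u)) * (2 * real \<omega> - 1)
    - 2 * (\<Sum>k<\<omega>. real (card {v \<in> far u. d u v \<le> k}))"
    by (simp add: sum_slack)
  moreover have "real (card (far u)) = real (card V) - 1 - real (deg u)"
    using card_V[OF u] by simp
  moreover have "2 * (\<Sum>k<\<omega>. real (k - 1)) = (real \<omega> - 1) * (real \<omega> - 2)"
    using sum_pred_real[OF \<omega>] by simp
  ultimately show ?thesis
    by (simp add: row_sum_bound_def sum_subtractf algebra_simps)
qed

lemma row_sum_le:
  assumes "u \<in> V" and "\<omega> > 0"
  shows "row_sum u \<le> row_sum_bound (card V) \<omega> (deg u)"
proof -
  have "(\<Sum>k<\<omega>. real (card {v \<in> far u. d u v \<le> k}) - real (k - 1)) \<ge> 0"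
    using card_far_ball_ge[OF assms(1)] by (intro sum_nonneg) auto
  then show ?thesis using row_sum_eq[OF assms] by simp
qed

text \<open>Only the radii 0 and 1 occur, and for them both the ball in \<open>far u\<close> and
  \<open>k - 1\<close> vanish.\<close>

lemma row_sum_eq_if_diam_le_2:
  assumes "u \<in> V" and "\<omega> > 0" and "\<omega> \<le> 2"
  shows "row_sum u = row_sum_bound (card V) \<omega> (deg u)"
proof -
  have "{v \<in> far u. d u v \<le> k} = {}" if "k < \<omega>" for k
    using that assms(3) by (auto simp: far_def)
  then have "(\<Sum>k<\<omega>. real (card {v \<in> far u. d u v \<le> k}) - real (k - 1)) = 0"
    using assms(3) by (intro sum.neutral) (auto simp del: Collect_empty_eq)
  then show ?thesis using row_sum_eq[OF assms(1,2)] by simp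
qed

text \<open>Equality makes the sum of nonnegative error terms vanish, hence every term;
  \<open>\<omega> \<ge> 3\<close> admits the term \<open>k = 2\<close>.\<close>

lemma card_sphere_2:
  assumes u: "u \<in> V" and \<omega>: "\<omega> \<ge> 3"
    and eq: "row_sum u = row_sum_bound (card V) \<omega> (deg u)"
  shows "card {v \<in> V. d u v = 2} = 1"
proof -
  have "(\<Sum>k<\<omega>. real (card {v \<in> far u. d u v \<le> k}) - real (k - 1)) = 0"
    using row_sum_eq[OF u] \<omega> eq by simp
  then have "\<forall>k\<in>{..<\<omega>}. real (card {v \<in> far u. d u v \<le> k}) - real (k - 1) = 0"
    using card_far_ball_ge[OF u] by (subst (asm) sum_nonneg_eq_0_iff) auto
  then have "card {v \<in> far u. d u v \<le> 2} = 1" using \<omega> by force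
  moreover have "{v \<in> far u. d u v \<le> 2} = {v \<in> V. d u v = 2}" by (auto simp: far_def)
  ultimately show ?thesis by simp
qed

text \<open>
  On a geodesic \<open>w0, w1, w2, w3\<close> the vertex \<open>w3\<close> is the only one at distance 2 from \<open>w1\<close>,
  so every neighbour of \<open>w0\<close> lies in the closed neighbourhood of \<open>w1\<close>, which contains \<open>w2\<close> besides.
\<close>

lemma diam_le_2_if_regular:
  assumes regular: "\<And>u v. u \<in> V \<Longrightarrow> v \<in> V \<Longrightarrow> deg u = deg v"
    and eq: "\<And>u. u \<in> V \<Longrightarrow> row_sum u = row_sum_bound (card V) \<omega> (deg u)"
  shows "\<omega> \<le> 2"
proof (rule ccontr)
  assume "\<not> \<omega> \<le> 2"
  then have \<omega>: "\<omega> \<ge> 3" by simp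
  obtain a b where ab: "a \<in> V" "b \<in> V" "d a b = \<omega>" using diam_attained by blast
  obtain w3 where w3: "w3 \<in> V" "d a w3 = Suc 2" using intermediate[OF ab(1,2), of 3] ab(3) \<omega> by auto
  obtain w2 where w2: "w2 \<in> V" "d a w2 = 2" "d w2 w3 = 1" using pred[OF ab(1) w3] by blast
  obtain w1 where w1: "w1 \<in> V" "d a w1 = 1" "d w1 w2 = 1" using pred[OF ab(1) w2(1), of 1] w2(2) by auto
  have "d w1 w3 = 2"
    using triangle[OF ab(1) w1(1) w3(1)] triangle[OF w1(1) w2(1) w3(1)] w1 w2 w3 by simp
  then have only: "v = w3" if "v \<in> V" "d w1 v = 2" for v
    using card_sphere_2[OF w1(1) \<omega> eq[OF w1(1)]] that w3(1) by (metis (mono_tags, lifting) card_1_singletonE mem_Collect_eq singletonD)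
  define Na where "Na = {v \<in> V. d a v = 1}"
  define N1 where "N1 = {v \<in> V. d w1 v = 1}"
  have fin: "finite Na" "finite N1" using finite_V by (auto simp: Na_def N1_def)
  have "d w1 v = 1" if v: "v \<in> V" "d a v = 1" "v \<noteq> w1" for v
  proof -
    have "d w1 v \<le> 2"
      using triangle[OF w1(1) ab(1) v(1)] sym[OF w1(1) ab(1)] v w1 by simp
    moreover have "d w1 v \<noteq> 2" using only[of v] v w3 by auto
    moreover have "d w1 v \<noteq> 0" using zero_iff[OF w1(1) v(1)] v by auto
    ultimately show ?thesis by simp
  qed
  moreover have "d w1 a = 1" using sym[OF w1(1) ab(1)] w1 by simp
  \<comment> \<open>Exchanging \<open>w1\<close> for \<open>a\<close> keeps the size of
    \<open>Na\<close>, and the additional \<open>w2\<close> makes \<open>N1\<close> strictly larger,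
    against regularity.\<close>
  ultimately have "insert a (insert w2 (Na - {w1})) \<subseteq> N1"
    using ab w1 w2 by (auto simp: Na_def N1_def)
  then have "card (insert a (insert w2 (Na - {w1}))) \<le> card N1"
    using fin by (simp add: card_mono)
  moreover have "a \<notin> insert w2 (Na - {w1})" "w2 \<notin> Na - {w1}"
    using zero_iff[OF ab(1) ab(1)] w2 by (auto simp: Na_def)
  moreover have "card Na = Suc (card (Na - {w1}))"
    using card.remove[OF fin(1), of w1] w1 by (simp add: Na_def)
  ultimately have "card Na < card N1" using fin by simp
  then show False using regular[OF ab(1) w1(1)] by (simp add: deg_def Na_def N1_def)
qed

lemma deg_if_diam_le_1:
  assumes "u \<in> V" and "\<omega> \<le> 1"
  shows "deg u = card V - 1"
proof -
  have "far u = {}" using le_diam[OF assms(1)] assms(2) by (fastforce simp: far_def)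
  then show ?thesis using card_V[OF assms(1)] by simp
qed

section \<open>From row sums to the spectral bound\<close>

lemma row_sum_pos:
  assumes u: "u \<in> V" and card: "card V \<ge> 2"
  shows "row_sum u > 0"
  unfolding row_sum_def
proof (rule sum_pos)
  show "finite (V - {u})" using finite_V by simp
  have "card (V - {u}) > 0" using u card finite_V by (simp add: card_Diff_singleton)
  then show "V - {u} \<noteq> {}" by (metis card.empty less_irrefl)
  show "2 * real (d u v) - 1 > 0" if "v \<in> V - {u}" for v
    using that zero_iff[OF u, of v] by (cases "d u v") auto
qed

text \<open>Since \<open>b\<close> does not increase with the degree, its product over two distinct
  vertices is largest at \<open>p\<close> and \<open>q\<close>, the vertices of smallest and second
  smallest degree. This removes the unknown pair that \<open>brauer_bound\<close> provides.\<close>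

lemma spectral_bound:
  fixes x :: "'a \<Rightarrow> real" and \<rho> :: real
  defines "b \<equiv> \<lambda>u. row_sum_bound (card V) \<omega> (deg u)"
  assumes card: "card V \<ge> 2"
    and p: "p \<in> V" and q: "q \<in> V" "p \<noteq> q"
    and min: "\<And>u. u \<in> V \<Longrightarrow> deg p \<le> deg u"
    and second: "\<And>u. u \<in> V \<Longrightarrow> u \<noteq> p \<Longrightarrow> deg q \<le> deg u"
    and x: "\<And>u. u \<in> V \<Longrightarrow> x u \<ge> 0" "\<exists>u\<in>V. x u > 0"
    and eig: "\<And>u. u \<in> V \<Longrightarrow> \<rho> * x u \<le> (\<Sum>v\<in>V - {u}. (2 * real (d u v) - 1) * x v)"
    and \<rho>: "\<rho> \<ge> 0"
  shows "\<rho> \<le> sqrt (b p * b q)"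
    and "\<rho> = sqrt (b p * b q) \<Longrightarrow> (\<forall>u\<in>V. deg u = deg p) \<and> \<omega> \<le> 2"
proof -
  have "d p q \<noteq> 0" using zero_iff[OF p q(1)] q(2) by simp
  then have \<omega>: "\<omega> > 0" using le_diam[OF p q(1)] by simp
  have b_mono: "b v \<le> b u" if "deg u \<le> deg v" for u v
  proof -
    have "(real (deg v) - real (deg u)) * (real \<omega> - 1) \<ge> 0" using that \<omega> by simp
    then show ?thesis by (simp add: b_def row_sum_bound_def algebra_simps)
  qed
  have T_le: "row_sum u \<le> b u" if "u \<in> V" for u
    using row_sum_le[OF that \<omega>] by (simp add: b_def)
  have T_pos: "row_sum u > 0" if "u \<in> V" for u
    using row_sum_pos[OF that card] .
  have b_pos: "b u > 0" if "u \<in> V" for u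
    using T_le[OF that] T_pos[OF that] by simp
  have m_pos: "2 * real (d u v) - 1 > 0" if "u \<in> V" "v \<in> V" "u \<noteq> v" for u v
    using that zero_iff[of u v] by (cases "d u v") auto
  obtain s t where st: "s \<in> V" "t \<in> V" "s \<noteq> t"
    and le: "\<rho>\<^sup>2 \<le> row_sum s * row_sum t"
    and eq: "\<rho>\<^sup>2 = row_sum s * row_sum t \<longrightarrow> card V \<ge> 3 \<longrightarrow> (\<forall>u\<in>V. \<rho> \<le> row_sum u)"
    by (rule brauer_bound[OF finite_V card m_pos x(1) x(2) eig \<rho>, folded row_sum_def];
        (rule that)?; assumption)
  have "row_sum s * row_sum t \<le> b s * b t"
    using st T_le T_pos b_pos by (intro mult_mono) (auto simp: less_imp_le)
  also have "b s * b t \<le> b p * b q"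
  \<comment> \<open>If \<open>s = p\<close>, then \<open>t\<close> differs from \<open>p\<close> and
    is compared with \<open>q\<close>; otherwise \<open>s\<close> is compared with \<open>q\<close>
    and \<open>t\<close> with \<open>p\<close>.\<close>
  proof (cases "s = p")
    case True
    then have "b t \<le> b q" using st second b_mono by blast
    then show ?thesis using True b_pos[OF p] by simp
  next
    case False
    then have "b s \<le> b q" "b t \<le> b p" using st min second b_mono by blast+
    then have "b s * b t \<le> b q * b p"
      using st p q b_pos by (intro mult_mono) (auto simp: less_imp_le)
    then show ?thesis by (simp add: mult.commute)
  qed
  finally have T_le_b: "row_sum s * row_sum t \<le> b p * b q" .
  with le show "\<rho> \<le> sqrt (b p * b q)" by (intro real_le_rsqrt) simp
  assume "\<rho> = sqrt (b p * b q)"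
  then have sq: "\<rho>\<^sup>2 = b p * b q" using b_pos p q by (simp add: less_imp_le)
  show "(\<forall>u\<in>V. deg u = deg p) \<and> \<omega> \<le> 2"
  \<comment> \<open>Diameter 1 is separate: \<open>\<omega> - 1\<close> vanishes, so
    \<open>b\<close> does not determine the degree, and there may be only two vertices. All degrees
    are then \<open>card V - 1\<close>.\<close>
  proof (cases "\<omega> \<le> 1")
    case True
    then show ?thesis using deg_if_diam_le_1 p by auto
  next
    case False
    obtain a c where ac: "a \<in> V" "c \<in> V" "d a c = \<omega>" using diam_attained by blast
    have "{..\<omega>} \<subseteq> d a ` V" using intermediate[OF ac(1,2)] ac(3) by fastforce
    then have "card {..\<omega>} \<le> card V" using finite_V by (intro surj_card_le)
    then have "card V \<ge> 3" using False by simp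
    \<comment> \<open>The chain from \<open>\<rho>\<close> squared through
      \<open>row_sum s * row_sum t\<close> to \<open>b p * b q\<close> collapses, which triggers the
      equality clause of \<open>brauer_bound\<close>.\<close>
    then have \<rho>_le: "\<rho> \<le> row_sum u" if "u \<in> V" for u
      using eq le T_le_b sq that by auto
    have "\<rho> > 0" using sq b_pos p q \<rho> by (metis less_eq_real_def mult_pos_pos power_zero_numeral less_irrefl)
    have "\<rho> \<le> b q" using \<rho>_le[OF q(1)] T_le[OF q(1)] by simp
    \<comment> \<open>From \<open>\<rho> \<le> b q\<close> and the value of \<open>\<rho>\<close>
      squared follows \<open>b p \<le> \<rho>\<close>, which closes the cycle
      \<open>b p \<le> \<rho> \<le> row_sum u \<le> b u \<le> b p\<close>.\<close>
    then have "b p * \<rho> \<le> \<rho> * \<rho>"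
      using b_pos[OF p] sq by (metis mult_left_mono less_imp_le power2_eq_square)
    then have "b p \<le> \<rho>" using \<open>\<rho> > 0\<close> by simp
    then have tight: "row_sum u = b u \<and> b u = b p" if "u \<in> V" for u
      using \<rho>_le[OF that] T_le[OF that] b_mono[OF min[OF that]] by simp
    have regular: "deg u = deg p" if "u \<in> V" for u
    proof -
      have "(real (deg u) - real (deg p)) * (real \<omega> - 1) = 0"
        using tight[OF that] by (simp add: b_def row_sum_bound_def algebra_simps)
      then show ?thesis using False by simp
    qed
    moreover have "\<omega> \<le> 2"
      using regular tight by (intro diam_le_2_if_regular) (auto simp: b_def)
    ultimately show ?thesis by blast
  qed
qed

end

subsection \<open>Graph distance\<close>

lemma degree_sequence_sorted_vertices:
  assumes "distinct vs" and "set vs = verts G"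
  shows "degree_sequence G = map (out_degree G) (sort_key (out_degree G) vs)"
proof -
  let ?us = "sort_key (out_degree G) vs"
  have "mset_set (verts G) = mset ?us"
    using assms by (metis mset_set_set mset_sort)
  then have "degree_sequence G = sort (map (out_degree G) ?us)"
    unfolding degree_sequence_def by (metis mset_map sorted_list_of_multiset_mset)
  also have "\<dots> = map (out_degree G) ?us"
    by (rule sorted_sort_id) simp
  finally show ?thesis .
qed

text \<open>Sorting the vertices by degree, instead of sorting the degrees, keeps the witnesses: the
  first two vertices are distinct even when their degrees coincide.\<close>

lemma two_smallest_degrees:
  assumes "distinct vs" and "set vs = verts G" and "card (verts G) \<ge> 2"
  obtains p q where "p \<in> verts G" "q \<in> verts G" "p \<noteq> q"
    "out_degree G p = min_degree G" "out_degree G q = second_min_degree G"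
    "\<And>u. u \<in> verts G \<Longrightarrow> u \<noteq> p \<Longrightarrow> second_min_degree G \<le> out_degree G u"
proof -
  define us where "us = sort_key (out_degree G) vs"
  have us: "distinct us" "set us = verts G" using assms by (auto simp: us_def)
  have len: "length us \<ge> 2" using us assms(3) by (metis distinct_card)
  have mono: "out_degree G (us ! i) \<le> out_degree G (us ! j)" if "i \<le> j" "j < length us" for i j
    using sorted_nth_mono[OF sorted_sort_key[of "out_degree G" vs], of i j] that by (simp add: us_def)
  have second: "second_min_degree G = out_degree G (us ! 1)"
    using degree_sequence_sorted_vertices[OF assms(1,2)] len
    by (simp add: second_min_degree_def us_def[symmetric])
  show ?thesis
  proof
    show "us ! 0 \<in> verts G" "us ! 1 \<in> verts G" using len by (auto simp flip: us(2) intro: nth_mem)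
    show "us ! 0 \<noteq> us ! 1" using us(1) len by (subst nth_eq_iff_index_eq) auto
    have "out_degree G (us ! 0) \<le> out_degree G u" if "u \<in> verts G" for u
      using that mono by (metis us(2) in_set_conv_nth zero_le)
    then show "out_degree G (us ! 0) = min_degree G"
      using \<open>us ! 0 \<in> verts G\<close> finite_set[of us] us(2) unfolding min_degree_def
      by (intro Min_eqI[symmetric]) auto
    show "out_degree G (us ! 1) = second_min_degree G" by (simp add: second)
    fix u assume "u \<in> verts G" "u \<noteq> us ! 0"
    then obtain i where "i < length us" "u = us ! i" "i \<noteq> 0" by (metis us(2) in_set_conv_nth)
    then show "second_min_degree G \<le> out_degree G u" using mono[of 1 i] by (simp add: second)
  qed
qed

section \<open>Distances through powers of the adjacency relation\<close>

context wf_digraph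
begin

text \<open>Relational powers forget the arcs of a walk, so concatenation and reversal become facts
  about \<open>^^\<close>.\<close>

lemma awalk_length_iff_relpow:
  assumes "u \<in> verts G"
  shows "(\<exists>p. awalk u p v \<and> length p = k) \<longleftrightarrow> (u, v) \<in> arcs_ends G ^^ k"
  using assms
proof (induction k arbitrary: u)
  case 0
  then show ?case by (auto simp: awalk_Nil_iff)
next
  case (Suc k)
  have "(\<exists>p. awalk u p v \<and> length p = Suc k) \<longleftrightarrow>
      (\<exists>e\<in>arcs G. tail G e = u \<and> (\<exists>p. awalk (head G e) p v \<and> length p = k))"
  proof
    assume "\<exists>p. awalk u p v \<and> length p = Suc k"
    then obtain e q where "awalk u (e # q) v" "length q = k" by (auto simp: length_Suc_conv)
    then show "\<exists>e\<in>arcs G. tail G e = u \<and> (\<exists>p. awalk (head G e) p v \<and> length p = k)"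
      unfolding awalk_Cons_iff by blast
  next
    assume "\<exists>e\<in>arcs G. tail G e = u \<and> (\<exists>p. awalk (head G e) p v \<and> length p = k)"
    then obtain e p where "e \<in> arcs G" "tail G e = u" "awalk (head G e) p v" "length p = k" by blast
    then show "\<exists>p. awalk u p v \<and> length p = Suc k"
      by (intro exI[of _ "e # p"]) (simp add: awalk_Cons_iff)
  qed
  also have "\<dots> \<longleftrightarrow> (\<exists>e\<in>arcs G. tail G e = u \<and> (head G e, v) \<in> arcs_ends G ^^ k)"
    using Suc.IH by auto
  also have "\<dots> \<longleftrightarrow> (\<exists>w. (u, w) \<in> arcs_ends G \<and> (w, v) \<in> arcs_ends G ^^ k)"
    by (auto simp: arcs_ends_conv)
  also have "\<dots> \<longleftrightarrow> (u, v) \<in> arcs_ends G ^^ Suc k"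
    by (metis relpow_Suc_D2 relpow_Suc_I2)
  finally show ?case .
qed

end

locale connected_graph = graph +
  assumes connected: "Digraph_Component.connected G"
begin

lemma reachable: "u \<in> verts G \<Longrightarrow> v \<in> verts G \<Longrightarrow> u \<rightarrow>\<^sup>* v"
  using symmetric_connected_imp_strongly_connected[OF sym_arcs connected]
  by (simp add: strongly_connected_def)

text \<open>\<open>vertex_dist\<close> minimises over paths only; the comparison with arbitrary
  walks goes through the unit cost \<open>\<mu>\<close>.\<close>

lemma vertex_dist_le_awalk:
  assumes "awalk u p v"
  shows "vertex_dist G u v \<le> length p"
proof -
  have cost: "awalk_cost (\<lambda>_. 1) q = real (length q)" for q
    by (induction q) auto
  have "u \<rightarrow>\<^sup>* v" using assms by (auto simp: reachable_awalk)
  then have "ereal (vertex_dist G u v) = \<mu> (\<lambda>_. 1) u v"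
    by (rule vertex_dist_eq_unit_cost[OF graph_axioms])
  also have "\<dots> \<le> awalk_cost (\<lambda>_. 1) p"
    using assms by (rule min_cost_le_walk_cost)
  finally show ?thesis by (simp add: cost)
qed

lemma vertex_dist_awalk:
  assumes "u \<in> verts G" "v \<in> verts G"
  obtains p where "awalk u p v" "length p = vertex_dist G u v"
proof -
  obtain q where "apath u q v" using reachable[OF assms] by (auto simp: reachable_apath)
  then have "\<exists>k p. apath u p v \<and> length p = k" by blast
  then have "\<exists>p. apath u p v \<and> length p = vertex_dist G u v"
    unfolding vertex_dist_def by (rule LeastI_ex)
  then show ?thesis using that by (auto intro: awalkI_apath)
qed

lemma vertex_dist_le:
  assumes "u \<in> verts G" "(u, v) \<in> arcs_ends G ^^ k"
  shows "vertex_dist G u v \<le> k"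
  using assms(2) vertex_dist_le_awalk unfolding awalk_length_iff_relpow[OF assms(1), symmetric] by blast

lemma vertex_dist_relpow:
  assumes "u \<in> verts G" "v \<in> verts G"
  shows "(u, v) \<in> arcs_ends G ^^ vertex_dist G u v"
  using vertex_dist_awalk[OF assms] unfolding awalk_length_iff_relpow[OF assms(1), symmetric] by blast

lemma relpow_arcs_ends_sym: "(u, v) \<in> arcs_ends G ^^ k \<Longrightarrow> (v, u) \<in> arcs_ends G ^^ k"
proof (induction k arbitrary: v)
  case (Suc k)
  then obtain w where "(u, w) \<in> arcs_ends G ^^ k" "(w, v) \<in> arcs_ends G" by auto
  then show ?case using Suc.IH graph_symmetric by (meson relpow_Suc_I2)
qed auto

lemma vertex_dist_eq_1_iff:
  assumes "u \<in> verts G" "v \<in> verts G"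
  shows "vertex_dist G u v = 1 \<longleftrightarrow> (u, v) \<in> arcs_ends G"
proof
  show "(u, v) \<in> arcs_ends G" if "vertex_dist G u v = 1"
    using vertex_dist_relpow[OF assms] that by simp
next
  assume arc: "(u, v) \<in> arcs_ends G"
  then have "u \<noteq> v" by (auto simp: arcs_ends_conv dest: no_loops)
  then have "vertex_dist G u v \<noteq> 0" using vertex_dist_relpow[OF assms] by (metis relpow_0_E)
  moreover have "vertex_dist G u v \<le> 1" using vertex_dist_le[OF assms(1), of v 1] arc by simp
  ultimately show "vertex_dist G u v = 1" by simp
qed

lemma vertex_dist_le_diameter:
  assumes "u \<in> verts G" "v \<in> verts G"
  shows "vertex_dist G u v \<le> diameter G"
proof -
  have "finite {vertex_dist G u v | u v. u \<in> verts G \<and> v \<in> verts G}"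
    by (rule finite_image_set2) auto
  then show ?thesis unfolding diameter_def using assms by (intro Max_ge) auto
qed

lemma diameter_attained: "\<exists>u\<in>verts G. \<exists>v\<in>verts G. vertex_dist G u v = diameter G"
proof -
  have "finite {vertex_dist G u v | u v. u \<in> verts G \<and> v \<in> verts G}"
    by (rule finite_image_set2) auto
  moreover obtain w where "w \<in> verts G"
    using symmetric_connected_imp_strongly_connected[OF sym_arcs connected]
    by (auto simp: strongly_connected_def)
  then have "{vertex_dist G u v | u v. u \<in> verts G \<and> v \<in> verts G} \<noteq> {}" by blast
  ultimately have "diameter G \<in> {vertex_dist G u v | u v. u \<in> verts G \<and> v \<in> verts G}"
    unfolding diameter_def by (rule Max_in)
  then show ?thesis by fastforce
qed

sublocale graph_metric "verts G" "vertex_dist G" "diameter G"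
proof
  show "finite (verts G)" by simp
next
  fix u v assume uv: "u \<in> verts G" "v \<in> verts G"
  show "vertex_dist G u v = 0 \<longleftrightarrow> u = v"
    using vertex_dist_relpow[OF uv] vertex_dist_le[OF uv(1), of v 0] by auto
  show "vertex_dist G u v = vertex_dist G v u"
    using vertex_dist_le[OF uv(1) relpow_arcs_ends_sym[OF vertex_dist_relpow[OF uv(2,1)]]]
      vertex_dist_le[OF uv(2) relpow_arcs_ends_sym[OF vertex_dist_relpow[OF uv]]] by simp
  show "vertex_dist G u w \<le> vertex_dist G u v + vertex_dist G v w" if "w \<in> verts G" for w
    using uv that vertex_dist_relpow[of u v] vertex_dist_relpow[of v w]
    by (intro vertex_dist_le) (auto simp: relpow_add)
  show "vertex_dist G u v \<le> diameter G" using uv by (rule vertex_dist_le_diameter)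
  fix k assume k: "vertex_dist G u v = Suc k"
  then obtain w where w: "(u, w) \<in> arcs_ends G ^^ k" "(w, v) \<in> arcs_ends G"
    using vertex_dist_relpow[OF uv] by auto
  then have wV: "w \<in> verts G" by (auto dest: adj_in_verts)
  then have w1: "vertex_dist G w v = 1" using w(2) uv vertex_dist_eq_1_iff by blast
  \<comment> \<open>Extending a shortest walk to \<open>w\<close> by the last arc shows that
    \<open>w\<close> is not closer to \<open>u\<close> than \<open>k\<close>.\<close>
  have "(u, v) \<in> arcs_ends G ^^ Suc (vertex_dist G u w)"
    using vertex_dist_relpow[OF uv(1) wV] w(2) by (rule relpow_Suc_I)
  then have "Suc k \<le> Suc (vertex_dist G u w)" using vertex_dist_le[OF uv(1)] k by metis
  then have "vertex_dist G u w = k" using vertex_dist_le[OF uv(1) w(1)] by simp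
  then show "\<exists>w\<in>verts G. vertex_dist G u w = k \<and> vertex_dist G w v = 1" using w1 wV by blast
next
  show "\<exists>u\<in>verts G. \<exists>v\<in>verts G. vertex_dist G u v = diameter G" by (rule diameter_attained)
qed

text \<open>Without parallel arcs, \<open>head G\<close> is injective on the arcs leaving
  \<open>u\<close>.\<close>

lemma deg_eq_out_degree:
  assumes "u \<in> verts G"
  shows "deg u = out_degree G u"
proof -
  have "bij_betw (head G) (out_arcs G u) {v \<in> verts G. vertex_dist G u v = 1}"
    unfolding bij_betw_def
  proof
    show "inj_on (head G) (out_arcs G u)"
      by (rule inj_onI) (auto intro!: no_multi_arcs simp: arc_to_ends_def)
    show "head G ` out_arcs G u = {v \<in> verts G. vertex_dist G u v = 1}"
      using assms vertex_dist_eq_1_iff[OF assms] by (force simp: arcs_ends_conv)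
  qed
  then show ?thesis unfolding deg_def out_degree_def by (simp add: bij_betw_same_card)
qed

end

subsection \<open>The distance Seidel matrix\<close>

lemma distance_seidel_matrix_carrier:
  "distance_seidel_matrix G vs \<in> carrier_mat (length vs) (length vs)"
  by (intro carrier_matI) (simp_all add: distance_seidel_matrix_def all_ones_matrix_def distance_matrix_def)

text \<open>The diagonal is tested by \<open>vs ! j = vs ! i\<close> instead of
  \<open>j = i\<close>, so that for fixed \<open>i\<close> the entry depends on \<open>j\<close>
  through \<open>vs ! j\<close> alone and row sums can be reindexed by
  \<open>sum_nth_remove\<close>.\<close>

lemma (in connected_graph) distance_seidel_matrix_nth:
  assumes "distinct vs" "set vs = verts G" "i < length vs" "j < length vs"
  shows "distance_seidel_matrix G vs $$ (i, j) =
    (if vs ! j = vs ! i then 0 else 1 - 2 * real (vertex_dist G (vs ! i) (vs ! j)))"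
proof -
  have "vs ! i \<in> verts G" using nth_mem[OF assms(3)] assms(2) by simp
  then have "vertex_dist G (vs ! i) (vs ! i) = 0" using zero_iff by simp
  then show ?thesis
    using assms
    by (auto simp: distance_seidel_matrix_def all_ones_matrix_def distance_matrix_def nth_eq_iff_index_eq)
qed

lemma sum_nth_remove:
  fixes f :: "'a \<Rightarrow> real"
  assumes "distinct vs" "i < length vs"
  shows "(\<Sum>j<length vs. if vs ! j = vs ! i then 0 else f (vs ! j)) = (\<Sum>v\<in>set vs - {vs ! i}. f v)"
proof -
  have "(\<Sum>j<length vs. if vs ! j = vs ! i then 0 else f (vs ! j))
      = (\<Sum>v\<in>set vs. if v = vs ! i then 0 else f v)"
    using assms(1) by (intro sum.reindex_bij_betw bij_betw_nth) auto
  also have "\<dots> = (\<Sum>v\<in>set vs - {vs ! i}. if v = vs ! i then 0 else f v)"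
    using assms(2) by (intro sum.mono_neutral_right) auto
  also have "\<dots> = (\<Sum>v\<in>set vs - {vs ! i}. f v)"
    by (intro sum.cong) auto
  finally show ?thesis .
qed

section \<open>Transfer between matrix indices and vertices\<close>

context connected_graph
begin

lemma seidel_radius_abs_eigenvector:
  assumes vs: "distinct vs" "set vs = verts G"
  obtains x :: "'a \<Rightarrow> real" where "\<And>u. u \<in> verts G \<Longrightarrow> x u \<ge> 0" "\<exists>u\<in>verts G. x u > 0"
    "\<And>u. u \<in> verts G \<Longrightarrow> distance_seidel_radius G vs * x u
      \<le> (\<Sum>v\<in>verts G - {u}. (2 * real (vertex_dist G u v) - 1) * x v)"
proof -
  let ?n = "length vs" and ?A = "distance_seidel_matrix G vs"
  have "verts G \<noteq> {}" using diameter_attained by auto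
  then have n: "?n > 0" using vs(2) by auto
  obtain y where y: "\<And>i. i < ?n \<Longrightarrow> y i \<ge> 0" "\<exists>i<?n. y i > 0"
    "\<And>i. i < ?n \<Longrightarrow> distance_seidel_radius G vs * y i \<le> (\<Sum>j<?n. \<bar>?A $$ (i, j)\<bar> * y j)"
    using spectral_radius_abs_eigenvector[OF distance_seidel_matrix_carrier n]
    unfolding distance_seidel_radius_def by blast
  define x where "x = y \<circ> inv_into {..<?n} ((!) vs)"
  have inj: "inj_on ((!) vs) {..<?n}" using vs(1) by (simp add: inj_on_nth)
  have x_nth: "x (vs ! i) = y i" if "i < ?n" for i
    using inv_into_f_f[OF inj, of i] that by (simp add: x_def)
  have nth: "\<exists>i<?n. u = vs ! i" if "u \<in> verts G" for u
    using that vs(2) by (metis in_set_conv_nth)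
  show ?thesis
  proof
    show "x u \<ge> 0" if "u \<in> verts G" for u using nth[OF that] x_nth y(1) by auto
    show "\<exists>u\<in>verts G. x u > 0" using y(2) x_nth vs(2) by (metis nth_mem)
  next
    fix u assume "u \<in> verts G"
    then obtain i where i: "i < ?n" "u = vs ! i" using nth by blast
    have entry: "\<bar>?A $$ (i, j)\<bar> * y j =
        (if vs ! j = vs ! i then 0 else (2 * real (vertex_dist G u (vs ! j)) - 1) * x (vs ! j))"
      if "j < ?n" for j
    proof (cases "vs ! j = vs ! i")
      case True
      then show ?thesis using distance_seidel_matrix_nth[OF vs i(1) that] by simp
    next
      case False
      have "u \<in> verts G" "vs ! j \<in> verts G" using nth_mem[OF i(1)] nth_mem[OF that] i(2) vs(2) by simp_all
      then have "vertex_dist G u (vs ! j) \<noteq> 0" using zero_iff[of u "vs ! j"] False i(2) by auto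
      then have "real (vertex_dist G u (vs ! j)) \<ge> 1" by linarith
      then show ?thesis
        using distance_seidel_matrix_nth[OF vs i(1) that] False i(2) x_nth[OF that] by simp
    qed
    have "(\<Sum>j<?n. \<bar>?A $$ (i, j)\<bar> * y j)
        = (\<Sum>v\<in>verts G - {u}. (2 * real (vertex_dist G u v) - 1) * x v)"
      using sum_nth_remove[OF vs(1) i(1), of "\<lambda>v. (2 * real (vertex_dist G u v) - 1) * x v"] entry
      by (simp add: vs(2) i(2))
    then show "distance_seidel_radius G vs * x u
        \<le> (\<Sum>v\<in>verts G - {u}. (2 * real (vertex_dist G u v) - 1) * x v)"
      using y(3)[OF i(1)] x_nth[OF i(1)] i(2) by simp
  qed
qed

text \<open>The matrix has constant row sums \<open>- c\<close>, so \<open>- c\<close> is an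
  eigenvalue, and its absolute value bounds \<open>c\<close>.\<close>

lemma row_sum_le_seidel_radius:
  assumes vs: "distinct vs" "set vs = verts G"
    and const: "\<And>u. u \<in> verts G \<Longrightarrow> row_sum u = c"
  shows "c \<le> distance_seidel_radius G vs"
proof -
  let ?n = "length vs" and ?A = "distance_seidel_matrix G vs"
  have "verts G \<noteq> {}" using diameter_attained by auto
  then have n: "?n > 0" using vs(2) by auto
  have "(\<Sum>j<?n. ?A $$ (i, j)) = - c" if i: "i < ?n" for i
  proof -
    have "(\<Sum>j<?n. ?A $$ (i, j)) =
        (\<Sum>j<?n. if vs ! j = vs ! i then 0 else 1 - 2 * real (vertex_dist G (vs ! i) (vs ! j)))"
      using distance_seidel_matrix_nth[OF vs i] by (intro sum.cong) auto
    also have "\<dots> = (\<Sum>v\<in>verts G - {vs ! i}. 1 - 2 * real (vertex_dist G (vs ! i) v))"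
      using sum_nth_remove[OF vs(1) i, of "\<lambda>v. 1 - 2 * real (vertex_dist G (vs ! i) v)"] vs(2) by simp
    also have "\<dots> = - row_sum (vs ! i)"
      unfolding row_sum_def sum_negf[symmetric] by simp
    also have "\<dots> = - c" using const[of "vs ! i"] nth_mem[OF i] vs(2) by simp
    finally show ?thesis .
  qed
  then have "\<bar>- c\<bar> \<le> distance_seidel_radius G vs"
    unfolding distance_seidel_radius_def
    by (rule abs_row_sum_le_spectral_radius[OF distance_seidel_matrix_carrier n])
  then show ?thesis by simp
qed

end

theorem theorem4p4:
  fixes G :: "('a, 'b) pre_digraph" and vs :: "'a list" and n \<omega> \<delta> \<delta>' :: nat
  assumes "graph G" and "Digraph_Component.connected G"
    and "n = card (verts G)" and "n \<ge> 2"
    and "distinct vs" and "set vs = verts G"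
    and "\<omega> = diameter G" and "\<delta> = min_degree G" and "\<delta>' = second_min_degree G"
  shows "distance_seidel_radius G vs \<le>
           sqrt ((- 2 * real \<delta> * (real \<omega> - 1) + real \<omega> * (1 - real \<omega>) + 2 * real n * real \<omega> - real n - 1)
               * (- 2 * real \<delta>' * (real \<omega> - 1) + real \<omega> * (1 - real \<omega>) + 2 * real n * real \<omega> - real n - 1))
       \<and> (distance_seidel_radius G vs =
           sqrt ((- 2 * real \<delta> * (real \<omega> - 1) + real \<omega> * (1 - real \<omega>) + 2 * real n * real \<omega> - real n - 1)
               * (- 2 * real \<delta>' * (real \<omega> - 1) + real \<omega> * (1 - real \<omega>) + 2 * real n * real \<omega> - real n - 1))
         \<longleftrightarrow> regular_graph G \<and> diameter G \<le> 2)"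
proof -
  interpret connected_graph G
    using assms(1,2) by (simp add: connected_graph_def connected_graph_axioms_def)
  note vs = assms(5,6)
  have card: "card (verts G) \<ge> 2" using assms(3,4) by simp
  obtain p q where pq: "p \<in> verts G" "q \<in> verts G" "p \<noteq> q"
    and deg: "out_degree G p = \<delta>" "out_degree G q = \<delta>'"
    and second: "\<And>u. u \<in> verts G \<Longrightarrow> u \<noteq> p \<Longrightarrow> \<delta>' \<le> out_degree G u"
    using two_smallest_degrees[OF vs card] assms(8,9) by metis
  have min: "\<delta> \<le> out_degree G u" if "u \<in> verts G" for u
    using that unfolding assms(8) min_degree_def by simp
  let ?\<rho> = "distance_seidel_radius G vs" and ?b = "row_sum_bound n \<omega>"
  have "length vs > 0" using card vs by (metis distinct_card gr_zeroI not_numeral_le_zero)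
  then have \<rho>: "?\<rho> \<ge> 0"
    unfolding distance_seidel_radius_def
    by (intro spectral_radius_nonneg[of _ "length vs"]) (simp_all add: distance_seidel_matrix_carrier)
  obtain x where x: "\<And>u. u \<in> verts G \<Longrightarrow> x u \<ge> 0" "\<exists>u\<in>verts G. x u > 0"
    "\<And>u. u \<in> verts G \<Longrightarrow> ?\<rho> * x u \<le> (\<Sum>v\<in>verts G - {u}. (2 * real (vertex_dist G u v) - 1) * x v)"
    using seidel_radius_abs_eigenvector[OF vs] by blast
  have deg_pq: "deg p = \<delta>" "deg q = \<delta>'" using deg pq deg_eq_out_degree by simp_all
  have deg_min: "deg p \<le> deg u" if "u \<in> verts G" for u
    using min[OF that] deg_pq deg_eq_out_degree[OF that] by simp
  have deg_second: "deg q \<le> deg u" if "u \<in> verts G" "u \<noteq> p" for u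
    using second[OF that] deg_pq deg_eq_out_degree[OF that(1)] by simp
  note bound = spectral_bound[OF card pq deg_min deg_second x \<rho>,
      unfolded deg_pq assms(3)[symmetric] assms(7)[symmetric]]
  have le: "?\<rho> \<le> sqrt (?b \<delta> * ?b \<delta>')"
    using bound(1) .
  have only_if: "regular_graph G \<and> diameter G \<le> 2" if "?\<rho> = sqrt (?b \<delta> * ?b \<delta>')"
  proof -
    have "\<forall>u\<in>verts G. deg u = \<delta>" "\<omega> \<le> 2" using bound(2)[OF _ _ _ _ _ that] by auto
    then show ?thesis using deg_eq_out_degree assms(7) by (auto simp: regular_graph_def)
  qed
  \<comment> \<open>All row sums equal \<open>?b \<delta>\<close>, which is thus a lower bound for
    \<open>?\<rho>\<close>; as \<open>\<delta>' = \<delta>\<close> and \<open>?b \<delta>\<close> is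
    positive, it is also the value of the root.\<close>
  have "?\<rho> = sqrt (?b \<delta> * ?b \<delta>')" if reg: "regular_graph G" and diam: "diameter G \<le> 2"
  proof -
    obtain k where k: "\<And>u. u \<in> verts G \<Longrightarrow> deg u = k"
      using reg deg_eq_out_degree unfolding regular_graph_def by metis
    have d: "\<delta>' = \<delta>" "\<And>u. u \<in> verts G \<Longrightarrow> deg u = \<delta>"
      using k pq deg_pq by auto
    have "vertex_dist G p q \<noteq> 0" using zero_iff pq by simp
    then have "diameter G > 0" using le_diam[OF pq(1,2)] by simp
    then have T: "row_sum u = ?b \<delta>" if "u \<in> verts G" for u
      using row_sum_eq_if_diam_le_2[OF that _ diam] d(2)[OF that] assms(3,7) by simp
    have "?b \<delta> > 0" using row_sum_pos[OF pq(1) card] T[OF pq(1)] by simp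
    then have "sqrt (?b \<delta> * ?b \<delta>') = ?b \<delta>" by (simp add: d(1))
    moreover have "?b \<delta> \<le> ?\<rho>" using row_sum_le_seidel_radius[OF vs T] .
    ultimately show ?thesis using le by simp
  qed
  with le only_if show ?thesis unfolding row_sum_bound_def by blast
qed

end
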